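(* Let $\mathcal{E}, f, S, A, b, \mathrm{Feas}, \bar e, f^*, \bar D, \hat f, \hat r$ be as in the context, and let $\{x_k'\}_{k\ge0}$ be the feasible sequence generated by Algorithm B (described in the context) with input $f^*,\bar e,\hat f$. Then for $0<\epsilon<1$, $$\ell\ \ge\ 4\left(\frac{\bar D}{\hat r}\right)^2\left(\frac43\Big(\frac{1-\epsilon}{\epsilon}\Big)^2+4\Big(\frac{1-\epsilon}{\epsilon}\Big)+\log_2\Big(\frac{1-\epsilon}{\epsilon}\Big)+\log_2\Big(\frac{\bar D}{\hat r}\Big)+1\right)$$ $$\Longrightarrow\quad \min_{k\le\ell}\frac{f(x_k')-f^*}{\hat f-f^*}\ \le\ \epsilon .$$
   Context: **Problem.** $\mathcal{E}$ is a finite-dimensional real vector space with inner product $\langle\cdot,\cdot\rangle$ and associated norm $\|\cdot\|$. $f:\mathcal{E}\to(-\infty,\infty]$ is an extended-valued, lower-semicontinuous convex function, $\mathrm{dom}(f)=\{x: f(x)<\infty\}$, $\mathrm{epi}(f)=\{(x,t)\in\mathcal E\times\mathbb R: x\in\mathrm{dom}(f),\ t\ge f(x)\}$. $S\subseteq\mathcal{E}$ is a closed convex set with nonempty interior, $A$ is a linear operator on $\mathcal E$, $b$ is a vector in its range space, and $\mathrm{Feas}=\{x\in S: Ax=b\}$. The problem is $\min f(x)$ s.t. $x\in\mathrm{Feas}$. The point $\bar e\in\mathrm{int}(S\cap\mathrm{dom}(f))$ is known and satisfies $A\bar e=b$. $\bar D$ is the diameter (supremum of distances between pairs of points) of $\{x\in\mathrm{Feas}: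 f(x)\le f(\bar e)\}$ and is assumed finite; hence the optimal value $f^*$ is attained. $\hat f$ is a user-chosen real number with $\hat f>f(\bar e)$, and $$\hat r:=\sup\{r : \|x-\bar e\|\le r \text{ and } Ax=b\ \Rightarrow\ x\in S\text{ and } f(x)\le\hat f\},$$ which is positive. **Line search.** For $x\in\mathcal E$, $t\in\mathbb R$ and scalars $\alpha$ let $x(\alpha)=\bar e+\alpha(x-\bar e)$, $t(\alpha)=\hat f+\alpha(t-\hat f)$; $\alpha_1(x)=\sup\{\alpha: x(\alpha)\in S\}$, $\alpha_2(x,t)=\sup\{\alpha: f(x(\alpha))\le t(\alpha)\}$, $\alpha(x,t)=\min\{\alpha_1(x),\alpha_2(x,t)\}$ (positive and finite whenever $Ax=b$ and $t<\hat f$). For such $(x,t)$, let $\pi'(x,t)=(\bar e,\hat f)+\alpha(x,t)\cdot((x,t)-(\bar e,\hat f))$. **The sets $G$.** $N_C(p)=\{v:\langle v,q-p\rangle\le0\ \forall q\in C\}$ denotes the normal cone to $C$ at $p$; on $\mathcal E\times\mathbb R$ the inner product assigning $(x_1,t_1),(x_2,t_2)$ the value $\langle x_1,x_2\rangle+t_1t_2$ is used. $\mathrm{bdy}$ denotes boundary. For $x'\in\mathrm{bdy}(S)$, $$G_1(x')=\Big\{\tfrac{-1}{\langle v,\bar e-x'\rangle}v : 0\ne v\in N_S(x')\Big\};$$ for $(x',t')\in\mathrm{bdy}(\mathrm{epi}(f))$, $$G_2(x',t')=\Big\{\tfrac{-1}{\langle v,\bar e-x'\rangle+(\hat f-t')\delta}v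 : (0,0)\ne(v,\delta)\in N_{\mathrm{epi}(f)}(x',t')\Big\}.$$ With $\mathrm{bdy}_1=\{(x',t'):x'\in\mathrm{bdy}(S)\}$ and $\mathrm{bdy}_2=\mathrm{bdy}(\mathrm{epi}(f))$, let $G(x',t')=G_1(x')$ if $(x',t')\in\mathrm{bdy}_1\setminus\mathrm{bdy}_2$; $G(x',t')=G_2(x',t')$ if $(x',t')\in\mathrm{bdy}_2\setminus\mathrm{bdy}_1$; and $G(x',t')$ is the convex hull of $G_1(x')\cup G_2(x',t')$ if $(x',t')\in\mathrm{bdy}_1\cap\mathrm{bdy}_2$. $P$ denotes orthogonal projection onto the kernel of $A$. **Algorithm B.** Input: $f^*$ (the optimal value), $\bar e$, $\hat f$. Initialize $x_0=\bar e$, $(x_0',t_0')=(\bar e,f(\bar e))$, $\alpha_0=\alpha(x_0,f^* )$. Iterate for $k=0,1,2,\dots$: - Compute $x_{k+1}=x_k+\frac{\alpha_k-1}{\alpha_k\|P(g')\|^2}P(g')$, where $g'\in G(x_k',t_k')$. - Let $(x_{k+1}',t_{k+1}')=\pi'(x_{k+1},f^* )$ and $\alpha_{k+1}=\alpha(x_{k+1},f^* )$. *)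

theory Defs
  imports "HOL-Analysis.Analysis"
begin

definition lsc :: "('a::topological_space \<Rightarrow> ereal) \<Rightarrow> bool" where
  "lsc f \<longleftrightarrow> (\<forall>x. f x \<le> Liminf (at x) f)"

(* Intended for functions that never take the value -\<infinity>, so that no sum of opposite infinities
   occurs; note that 0 * \<infinity> = 0 in ereal, which makes the cases u = 0 and u = 1 trivial. *)
definition ereal_convex :: "('a::real_vector \<Rightarrow> ereal) \<Rightarrow> bool" where
  "ereal_convex f \<longleftrightarrow>
     (\<forall>x y. \<forall>u\<in>{0..1::real}.
        f (u *\<^sub>R x + (1 - u) *\<^sub>R y) \<le> ereal u * f x + ereal (1 - u) * f y)"

definition edom :: "('a \<Rightarrow> ereal) \<Rightarrow> 'a set" where
  "edom f = {x. f x < \<infinity>}"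

definition epi :: "('a \<Rightarrow> ereal) \<Rightarrow> ('a \<times> real) set" where
  "epi f = {(x, t). x \<in> edom f \<and> f x \<le> ereal t}"

definition Feas :: "('a \<Rightarrow> 'b) \<Rightarrow> 'b \<Rightarrow> 'a set \<Rightarrow> 'a set" where
  "Feas A b S = {x \<in> S. A x = b}"

definition opt_val :: "('a \<Rightarrow> ereal) \<Rightarrow> ('a \<Rightarrow> 'b) \<Rightarrow> 'b \<Rightarrow> 'a set \<Rightarrow> ereal" where
  "opt_val f A b S = (INF x\<in>Feas A b S. f x)"

definition init_level_set ::
    "('a \<Rightarrow> ereal) \<Rightarrow> ('a \<Rightarrow> 'b) \<Rightarrow> 'b \<Rightarrow> 'a set \<Rightarrow> 'a \<Rightarrow> 'a set" where
  "init_level_set f A b S e = {x \<in> Feas A b S. f x \<le> f e}"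

(* Real supremum.  For the data considered here (bounded initial level set) the set of radii is
   unbounded only if the kernel of A is trivial, in which case e is the only feasible point. *)
definition r_hat ::
    "('a::real_normed_vector \<Rightarrow> ereal) \<Rightarrow> ('a \<Rightarrow> 'b) \<Rightarrow> 'b \<Rightarrow> 'a set \<Rightarrow> 'a \<Rightarrow> real \<Rightarrow> real" where
  "r_hat f A b S e fhat =
     Sup {r::real. \<forall>x. norm (x - e) \<le> r \<and> A x = b \<longrightarrow> x \<in> S \<and> f x \<le> ereal fhat}"

(* Either supremum may be \<infinity>, hence the values in ereal; only their minimum is finite in general. *)
definition alpha1 :: "'a::real_vector set \<Rightarrow> 'a \<Rightarrow> 'a \<Rightarrow> ereal" where
  "alpha1 S e x = Sup {ereal a | a. e + a *\<^sub>R (x - e) \<in> S}"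

definition alpha2 ::
    "('a::real_vector \<Rightarrow> ereal) \<Rightarrow> 'a \<Rightarrow> real \<Rightarrow> 'a \<Rightarrow> real \<Rightarrow> ereal" where
  "alpha2 f e fhat x t =
     Sup {ereal a | a. f (e + a *\<^sub>R (x - e)) \<le> ereal (fhat + a * (t - fhat))}"

definition alpha ::
    "('a::real_vector \<Rightarrow> ereal) \<Rightarrow> 'a set \<Rightarrow> 'a \<Rightarrow> real \<Rightarrow> 'a \<Rightarrow> real \<Rightarrow> real" where
  "alpha f S e fhat x t = real_of_ereal (min (alpha1 S e x) (alpha2 f e fhat x t))"

definition pi' ::
    "('a::real_vector \<Rightarrow> ereal) \<Rightarrow> 'a set \<Rightarrow> 'a \<Rightarrow> real \<Rightarrow> 'a \<Rightarrow> real \<Rightarrow> 'a \<times> real" where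
  "pi' f S e fhat x t = (e, fhat) + alpha f S e fhat x t *\<^sub>R ((x, t) - (e, fhat))"

definition normal_cone :: "'a::real_inner set \<Rightarrow> 'a \<Rightarrow> 'a set" where
  "normal_cone C p = {v. \<forall>q\<in>C. v \<bullet> (q - p) \<le> 0}"

definition G1 :: "'a::real_inner set \<Rightarrow> 'a \<Rightarrow> 'a \<Rightarrow> 'a set" where
  "G1 S e x' = {(- 1 / (v \<bullet> (e - x'))) *\<^sub>R v | v. v \<noteq> 0 \<and> v \<in> normal_cone S x'}"

definition G2 ::
    "('a::real_inner \<Rightarrow> ereal) \<Rightarrow> 'a \<Rightarrow> real \<Rightarrow> 'a \<Rightarrow> real \<Rightarrow> 'a set" where
  "G2 f e fhat x' t' =
     {(- 1 / (v \<bullet> (e - x') + (fhat - t') * d)) *\<^sub>R v | v d.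
        (v, d) \<noteq> (0, 0) \<and> (v, d) \<in> normal_cone (epi f) (x', t')}"

definition bdy1 :: "'a::topological_space set \<Rightarrow> ('a \<times> real) set" where
  "bdy1 S = {(x', t'). x' \<in> frontier S}"

definition bdy2 :: "('a::topological_space \<Rightarrow> ereal) \<Rightarrow> ('a \<times> real) set" where
  "bdy2 f = frontier (epi f)"

(* The value {} outside bdy1 \<union> bdy2 is arbitrary. *)
definition G ::
    "('a::real_inner \<Rightarrow> ereal) \<Rightarrow> 'a set \<Rightarrow> 'a \<Rightarrow> real \<Rightarrow> 'a \<times> real \<Rightarrow> 'a set" where
  "G f S e fhat z =
     (if z \<in> bdy1 S - bdy2 f then G1 S e (fst z)
      else if z \<in> bdy2 f - bdy1 S then G2 f e fhat (fst z) (snd z)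
      else if z \<in> bdy1 S \<inter> bdy2 f then
        convex hull (G1 S e (fst z) \<union> G2 f e fhat (fst z) (snd z))
      else {})"

definition ortho_proj :: "'a::real_inner set \<Rightarrow> 'a \<Rightarrow> 'a" where
  "ortho_proj V x = (THE p. p \<in> V \<and> (\<forall>w\<in>V. orthogonal (x - p) w))"

(* The sequences x, z, al hold the points x_k, the pairs (x_k', t_k') and the scalars alpha_k of
   a run; at each step the element g of G is arbitrary.  If the projection of g is 0, then the
   update (division by 0) leaves x_k unchanged; this happens only at an optimal x_k'. *)
definition algorithm_B ::
    "('a::real_inner \<Rightarrow> ereal) \<Rightarrow> 'a set \<Rightarrow> ('a \<Rightarrow> 'b::real_vector) \<Rightarrow> real \<Rightarrow> 'a \<Rightarrow> real \<Rightarrow>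
     (nat \<Rightarrow> 'a) \<Rightarrow> (nat \<Rightarrow> 'a \<times> real) \<Rightarrow> (nat \<Rightarrow> real) \<Rightarrow> bool" where
  "algorithm_B f S A fstar e fhat x z al \<longleftrightarrow>
     x 0 = e \<and> z 0 = (e, real_of_ereal (f e)) \<and> al 0 = alpha f S e fhat (x 0) fstar \<and>
     (\<forall>k. (\<exists>g \<in> G f S e fhat (z k).
             let p = ortho_proj {y. A y = 0} g in
               x (Suc k) = x k + ((al k - 1) / (al k * (norm p)\<^sup>2)) *\<^sub>R p) \<and>
          z (Suc k) = pi' f S e fhat (x (Suc k)) fstar \<and>
          al (Suc k) = alpha f S e fhat (x (Suc k)) fstar)"

end

theory Submission
  imports Defs
begin

text \<open>
  Let \<open>K = epi f \<inter> (S \<times> \<real>)\<close> and \<open>\<gamma> x = 1 / \<alpha>(x, f*)\<close>, the Minkowski gauge of \<open>K - (e, fhat)\<close> at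
  \<open>(x - e, f* - fhat)\<close>.  On \<open>{x. A x = b}\<close> its minimum is \<open>1\<close>, attained at the optimal solutions, and
  the elements of \<open>G\<close> are subgradients of \<open>\<gamma>\<close>; their projections onto the kernel of \<open>A\<close> have norm at
  most \<open>1 / r\<close>, because the ball of radius \<open>r\<close> about \<open>(e, fhat)\<close> in kernel directions lies in \<open>K\<close>.
  Algorithm B is thus Polyak's subgradient method with known optimal value \<open>1\<close>, so that
  \<open>r\<^sup>2 (\<Sum>k\<le>l. (\<gamma> x\<^sub>k - 1)\<^sup>2) \<le> D\<^sup>2\<close>, whereas a relative error above \<open>eps\<close> at \<open>x\<^sub>k'\<close> forces
  \<open>\<gamma> x\<^sub>k - 1 > eps / (1 - eps) = 1 / w\<close>.  This settles the case \<open>w D / r > 1\<close>, where the logarithmic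
  terms of the bound add up to something positive.  If \<open>w D / r \<le> 1\<close>, the bound may be vacuous, but then
  \<open>e\<close> itself is good enough: moving from \<open>e\<close> by \<open>r\<close> away from an optimal solution keeps \<open>f \<le> fhat\<close>, and
  convexity on this line gives \<open>(f e - f*) r \<le> D (fhat - f e)\<close>.
\<close>

section \<open>Epigraphs of lower-semicontinuous convex functions\<close>

lemma mem_epi: "(y, t) \<in> epi f \<longleftrightarrow> f y \<le> ereal t"
  by (auto simp: epi_def edom_def dest: order.strict_trans1[of _ "ereal t" "\<infinity>"])

lemma convex_epi:
  assumes "ereal_convex f"
  shows "convex (epi f)"
  unfolding convex_alt
proof (intro ballI allI impI)
  fix p q :: "'a \<times> real" and u :: real
  assume p: "p \<in> epi f" and q: "q \<in> epi f" and u: "0 \<le> u \<and> u \<le> 1"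
  obtain x s where ps: "p = (x, s)" by (cases p)
  obtain y t where qt: "q = (y, t)" by (cases q)
  have le: "f x \<le> ereal s" "f y \<le> ereal t"
    using p q by (auto simp: ps qt mem_epi)
  have "f ((1 - u) *\<^sub>R x + (1 - (1 - u)) *\<^sub>R y) \<le> ereal (1 - u) * f x + ereal (1 - (1 - u)) * f y"
    using assms u unfolding ereal_convex_def by fastforce
  also have "\<dots> \<le> ereal (1 - u) * ereal s + ereal u * ereal t"
    using le u add_mono[OF ereal_mult_left_mono[of "f x" "ereal s" "ereal (1 - u)"]
        ereal_mult_left_mono[of "f y" "ereal t" "ereal u"]] by simp
  finally show "(1 - u) *\<^sub>R p + u *\<^sub>R q \<in> epi f"
    by (simp add: ps qt mem_epi)
qed

lemma closed_epi:
  fixes f :: "'a::metric_space \<Rightarrow> ereal"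
  assumes "lsc f"
  shows "closed (epi f)"
  unfolding closed_sequential_limits
proof (intro allI impI, elim conjE)
  fix X :: "nat \<Rightarrow> 'a \<times> real" and p
  assume X: "\<forall>n. X n \<in> epi f" and lim: "X \<longlonglongrightarrow> p"
  obtain y t where p: "p = (y, t)" by (cases p)
  have lim1: "(\<lambda>n. fst (X n)) \<longlonglongrightarrow> y" and lim2: "(\<lambda>n. snd (X n)) \<longlonglongrightarrow> t"
    using tendsto_fst[OF lim] tendsto_snd[OF lim] by (simp_all add: p)
  have "f y \<le> ereal t"
  proof (rule ccontr)
    assume "\<not> f y \<le> ereal t"
    then obtain c where c: "ereal t < c" "c < f y"
      using dense[of "ereal t" "f y"] by (auto simp: not_le)
    \<comment> \<open>The level \<open>c\<close> may be infinite; a further value strictly between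
      \<open>ereal t\<close> and \<open>c\<close> is a real number.\<close>
    obtain c' where c': "ereal t < c'" "c' < c" using dense c(1) by blast
    then obtain s where s: "c' = ereal s" by (cases c') auto
    have "ereal s < f y" using c c' s by auto
    moreover have "f y \<le> Liminf (at y) f" using assms by (simp add: lsc_def)
    ultimately have "eventually (\<lambda>w. ereal s < f w) (at y)"
      using le_Liminf_iff[of "f y" "at y" f] by blast
    \<comment> \<open>\<open>Liminf (at y) f\<close> ignores the point \<open>y\<close> itself, so
      \<open>ereal s < f y\<close> is added by hand.\<close>
    then have "eventually (\<lambda>w. ereal s < f w) (nhds y)"
      using \<open>ereal s < f y\<close> by (metis (mono_tags, lifting) eventually_nhds_conv_at)
    then have "eventually (\<lambda>n. ereal s < f (fst (X n))) sequentially"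
      using lim1 unfolding filterlim_iff by blast
    moreover have "eventually (\<lambda>n. snd (X n) < s) sequentially"
      using order_tendstoD(2)[OF lim2] c' s by simp
    ultimately have "eventually (\<lambda>n. False) sequentially"
    proof eventually_elim
      case (elim n)
      have "f (fst (X n)) \<le> ereal (snd (X n))"
        using X mem_epi[of "fst (X n)" "snd (X n)" f] by simp
      also have "\<dots> < ereal s" using elim by simp
      finally show ?case using elim by simp
    qed
    then show False by simp
  qed
  then show "p \<in> epi f" by (simp add: p mem_epi)
qed

text \<open>A convex function that is finite near \<open>e\<close> is continuous there, so it stays
  below some \<open>c < h\<close> on a neighbourhood \<open>U\<close>, and
  \<open>U \<times> {c<..}\<close> is an open part of the epigraph around
  \<open>(e, h)\<close>.\<close>

lemma interior_epi:
  fixes f :: "'a::euclidean_space \<Rightarrow> ereal"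
  assumes ninf: "\<And>y. f y \<noteq> -\<infinity>" and conv: "ereal_convex f"
    and e: "e \<in> interior (edom f)" and lt: "f e < ereal h"
  shows "(e, h) \<in> interior (epi f)"
proof -
  obtain d where d: "d > 0" "ball e d \<subseteq> edom f"
    using e by (meson mem_interior)
  define g where "g = (\<lambda>y. real_of_ereal (f y))"
  have fg: "f y = ereal (g y)" if "y \<in> ball e d" for y
  proof -
    have "f y < \<infinity>" using that d by (auto simp: edom_def)
    then show ?thesis using ninf[of y] by (cases "f y") (auto simp: g_def)
  qed
  have "convex_on (ball e d) g"
  proof (rule convex_onI)
    fix t :: real and x y
    assume t: "0 < t" "t < 1" and xy: "x \<in> ball e d" "y \<in> ball e d"
    have m: "(1 - t) *\<^sub>R x + t *\<^sub>R y \<in> ball e d"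
      using convex_ball[of e d] xy t unfolding convex_alt by auto
    have "f ((1 - t) *\<^sub>R x + (1 - (1 - t)) *\<^sub>R y) \<le> ereal (1 - t) * f x + ereal (1 - (1 - t)) * f y"
      using conv t unfolding ereal_convex_def by fastforce
    then show "g ((1 - t) *\<^sub>R x + t *\<^sub>R y) \<le> (1 - t) * g x + t * g y"
      using m xy by (simp add: fg)
  qed simp
  then have "continuous_on (ball e d) g"
    by (intro convex_on_continuous) auto
  then have cont: "isCont g e"
    using d by (simp add: continuous_on_eq_continuous_at)
  have "g e < h" using lt d by (simp add: fg)
  then obtain c where c: "g e < c" "c < h" using dense by blast
  have "eventually (\<lambda>y. g y < c) (nhds e)"
    using order_tendstoD(2)[of g "g e" "at e" c] cont c
    by (simp add: isCont_def eventually_nhds_conv_at)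
  moreover have "eventually (\<lambda>y. y \<in> ball e d) (nhds e)"
    using d by (intro eventually_nhds_in_open) auto
  ultimately have "eventually (\<lambda>y. f y \<le> ereal c) (nhds e)"
    by eventually_elim (auto simp: fg simp del: mem_ball)
  then obtain U where U: "open U" "e \<in> U" "\<And>y. y \<in> U \<Longrightarrow> f y \<le> ereal c"
    by (auto simp: eventually_nhds)
  have "U \<times> {c<..} \<subseteq> epi f"
  proof (clarsimp simp: mem_epi)
    fix y t assume "y \<in> U" "c < t"
    then show "f y \<le> ereal t" using U(3)[of y] order_trans[of "f y" "ereal c" "ereal t"] by simp
  qed
  moreover have "open (U \<times> {c<..})" using U by (intro open_Times) auto
  ultimately show ?thesis using U c by (auto intro!: interiorI[of "U \<times> {c<..}"])
qed

section \<open>Normal cones, supporting functionals and the sets \<open>G\<close>\<close>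

lemma normal_cone_interior_neg:
  fixes v :: "'a::real_inner"
  assumes "c \<in> interior C" and "v \<in> normal_cone C p" and "v \<noteq> 0"
  shows "v \<bullet> (c - p) < 0"
proof -
  obtain d where d: "d > 0" "cball c d \<subseteq> C"
    using assms(1) by (meson mem_interior_cball)
  \<comment> \<open>Testing normality at a point pushed from \<open>c\<close> in the direction
    \<open>v\<close> gains \<open>d * norm v\<close>, which makes the inequality strict.\<close>
  have "c + (d / norm v) *\<^sub>R v \<in> C"
    using d assms(3) by (intro subsetD[OF d(2)]) (simp add: dist_norm)
  then have "v \<bullet> (c + (d / norm v) *\<^sub>R v - p) \<le> 0"
    using assms(2) by (simp add: normal_cone_def)
  then have "v \<bullet> (c - p) + d / norm v * (v \<bullet> v) \<le> 0"
    by (simp add: inner_diff_right inner_add_right)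
  moreover have "d / norm v * (v \<bullet> v) > 0" using d assms(3) by simp
  ultimately show ?thesis by linarith
qed

text \<open>The pair \<open>(g, d)\<close> lies in the polar of \<open>K - c\<close> and attains 1
  at \<open>z - c\<close>; for \<open>z\<close> in \<open>K\<close> it is thus a subgradient there
  of the gauge of \<open>K - c\<close>. The component \<open>d\<close> is hidden because
  \<open>G\<close> keeps only the first component of a normal vector.\<close>

definition supports ::
    "('a::real_inner \<times> real) set \<Rightarrow> 'a \<times> real \<Rightarrow> 'a \<times> real \<Rightarrow> 'a \<Rightarrow> bool" where
  "supports K c z g \<longleftrightarrow>
     (\<exists>d. (g, d) \<bullet> (z - c) = 1 \<and> (\<forall>q\<in>K. (g, d) \<bullet> (q - c) \<le> 1))"

text \<open>This handles the convex hull in \<open>G\<close>: both conditions are affine in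
  \<open>(g, d)\<close>, so the same combination of the hidden components is a witness.\<close>

lemma convex_supports: "convex {g. supports K c z g}"
  unfolding convex_alt
proof (intro ballI allI impI, elim CollectE, intro CollectI)
  fix g h and u :: real
  assume "supports K c z g" "supports K c z h" and u: "0 \<le> u \<and> u \<le> 1"
  then obtain d d' where d: "(g, d) \<bullet> (z - c) = 1" "\<forall>q\<in>K. (g, d) \<bullet> (q - c) \<le> 1"
    and d': "(h, d') \<bullet> (z - c) = 1" "\<forall>q\<in>K. (h, d') \<bullet> (q - c) \<le> 1"
    unfolding supports_def by blast
  have eq: "((1 - u) *\<^sub>R g + u *\<^sub>R h, (1 - u) * d + u * d') \<bullet> w
      = (1 - u) * ((g, d) \<bullet> w) + u * ((h, d') \<bullet> w)" for w
    by (cases w) (simp add: inner_add_left algebra_simps)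
  show "supports K c z ((1 - u) *\<^sub>R g + u *\<^sub>R h)"
    unfolding supports_def
  proof (intro exI conjI ballI)
    show "((1 - u) *\<^sub>R g + u *\<^sub>R h, (1 - u) * d + u * d') \<bullet> (z - c) = 1"
      unfolding eq using d d' by simp
    fix q assume "q \<in> K"
    then have "(g, d) \<bullet> (q - c) \<le> 1" "(h, d') \<bullet> (q - c) \<le> 1" using d d' by auto
    then show "((1 - u) *\<^sub>R g + u *\<^sub>R h, (1 - u) * d + u * d') \<bullet> (q - c) \<le> 1"
      unfolding eq using u by (intro convex_bound_le) auto
  qed
qed

text \<open>Normality at \<open>z\<close> bounds \<open>v \<bullet> (q - c)\<close> by
  \<open>v \<bullet> (z - c)\<close>, which is positive because \<open>c\<close> is interior; the
  factor in \<open>G1\<close> and \<open>G2\<close> scales this bound to 1. Taking \<open>K\<close>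
  smaller than \<open>C\<close> lets \<open>epi f\<close> and the cylinder over \<open>S\<close> be
  treated alike.\<close>

lemma normalized_normal_supports:
  fixes v :: "'a::real_inner \<times> real"
  assumes "c \<in> interior C" and "v \<in> normal_cone C z" and "v \<noteq> 0" and "K \<subseteq> C"
  shows "supports K c z (fst ((- 1 / (v \<bullet> (c - z))) *\<^sub>R v))"
proof -
  define m where "m = v \<bullet> (c - z)"
  have m: "m < 0" unfolding m_def using assms by (intro normal_cone_interior_neg)
  show ?thesis
    unfolding supports_def
  proof (intro exI conjI ballI)
    let ?w = "(fst ((- 1 / (v \<bullet> (c - z))) *\<^sub>R v), snd ((- 1 / (v \<bullet> (c - z))) *\<^sub>R v))"
    have eq: "?w \<bullet> (q - c) = - (v \<bullet> (q - c)) / m" for q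
      by (simp add: m_def inner_prod_def fst_diff snd_diff divide_simps)
    have "v \<bullet> (z - c) = - m" by (simp add: m_def inner_diff_right)
    then show "?w \<bullet> (z - c) = 1" unfolding eq using m by simp
    fix q assume "q \<in> K"
    then have "v \<bullet> (q - z) \<le> 0" using assms by (auto simp: normal_cone_def)
    then have "v \<bullet> (q - c) \<le> - m" by (simp add: m_def inner_diff_right)
    then show "?w \<bullet> (q - c) \<le> 1" unfolding eq using m by (simp add: divide_simps)
  qed
qed

lemma G_supports:
  fixes f :: "'a::real_inner \<Rightarrow> ereal"
  assumes S: "e \<in> interior S" and epi: "(e, h) \<in> interior (epi f)"
    and g: "g \<in> G f S e h z"
  shows "supports (epi f \<inter> S \<times> UNIV) (e, h) z g"
proof -
  have 1: "supports (epi f \<inter> S \<times> UNIV) (e, h) z g'" if "g' \<in> G1 S e (fst z)" for g'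
  proof -
    obtain v where v: "g' = (- 1 / (v \<bullet> (e - fst z))) *\<^sub>R v" "v \<noteq> 0" "v \<in> normal_cone S (fst z)"
      using \<open>g' \<in> _\<close> by (auto simp: G1_def)
    have "(e, h) \<in> interior (S \<times> UNIV)" using S by (simp add: interior_Times)
    \<comment> \<open>A normal vector of \<open>S\<close> extends to the cylinder by a zero last
      component, and the denominator of \<open>G1\<close> then agrees with the inner product on
      pairs.\<close>
    moreover have "(v, 0) \<in> normal_cone (S \<times> (UNIV :: real set)) z"
      using v(3) by (auto simp: normal_cone_def inner_prod_def)
    ultimately have "supports (epi f \<inter> S \<times> UNIV) (e, h) z
        (fst ((- 1 / ((v, 0) \<bullet> ((e, h) - z))) *\<^sub>R (v, 0 :: real)))"
      using v(2) by (intro normalized_normal_supports) (auto simp: zero_prod_def)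
    then show ?thesis by (simp add: v(1) inner_prod_def)
  qed
  have 2: "supports (epi f \<inter> S \<times> UNIV) (e, h) z g'" if g': "g' \<in> G2 f e h (fst z) (snd z)" for g'
  proof -
    obtain v d where v: "g' = (- 1 / (v \<bullet> (e - fst z) + (h - snd z) * d)) *\<^sub>R v"
      "(v, d) \<noteq> (0, 0)" "(v, d) \<in> normal_cone (epi f) z"
      using g' by (auto simp: G2_def)
    have "supports (epi f \<inter> S \<times> UNIV) (e, h) z
        (fst ((- 1 / ((v, d) \<bullet> ((e, h) - z))) *\<^sub>R (v, d)))"
      using v(2,3) epi by (intro normalized_normal_supports) (auto simp: zero_prod_def)
    then show ?thesis by (simp add: v(1) inner_prod_def mult.commute)
  qed
  have "convex hull (G1 S e (fst z) \<union> G2 f e h (fst z) (snd z))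
      \<subseteq> {g. supports (epi f \<inter> S \<times> UNIV) (e, h) z g}"
    by (intro hull_minimal convex_supports) (auto intro: 1 2)
  then show ?thesis using g 1 2 by (auto simp: G_def split: if_splits)
qed

section \<open>The line search\<close>

lemma min_Sup_closed_convex:
  fixes T U :: "real set"
  assumes T: "closed T" "convex T" "0 \<in> T" and U: "closed U" "convex U" "0 \<in> U"
    and a: "a \<in> T \<inter> U" "0 < a" and bd: "\<And>a. a \<in> T \<inter> U \<Longrightarrow> a \<le> c"
  defines "m \<equiv> real_of_ereal (min (Sup (ereal ` T)) (Sup (ereal ` U)))"
  shows "m \<in> T \<inter> U" and "0 < m" and "m \<le> c"
proof -
  let ?M = "min (Sup (ereal ` T)) (Sup (ereal ` U))"
  \<comment> \<open>Both sets are intervals through 0, so every nonnegative number below both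
    suprema lies in both. The minimum is therefore a limit of common points, and closedness includes
    it, even if one supremum is infinite.\<close>
  have down: "s \<in> T \<inter> U" if "0 \<le> s" "ereal s < ?M" for s
  proof -
    have "ereal s < Sup (ereal ` T)" "ereal s < Sup (ereal ` U)" using that by auto
    then obtain t u where tu: "t \<in> T" "s < t" "u \<in> U" "s < u"
      unfolding less_Sup_iff by auto
    have "closed_segment 0 t \<subseteq> T" "closed_segment 0 u \<subseteq> U"
      using T U tu by (auto simp: closed_segment_subset)
    then have "{0..t} \<subseteq> T" "{0..u} \<subseteq> U"
      using that tu by (auto simp: closed_segment_eq_real_ivl)
    then show ?thesis using that tu by auto
  qed
  have "ereal a \<le> ?M" using a by (auto intro!: Sup_upper)
  moreover have "?M \<le> ereal c"
  proof (rule ccontr)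
    assume "\<not> ?M \<le> ereal c"
    then obtain x where x: "ereal c < x" "x < ?M" using dense[of "ereal c" ?M] by (auto simp: not_le)
    then obtain y where y: "x = ereal y" by (cases x) (auto dest: less_le_trans)
    have "c \<ge> 0" using bd[OF a(1)] a(2) by simp
    then have "y \<in> T \<inter> U" using x y by (intro down) auto
    then show False using bd x y by fastforce
  qed
  ultimately have M: "?M = ereal m"
    unfolding m_def by (cases ?M) auto
  then show "0 < m" "m \<le> c" using \<open>ereal a \<le> ?M\<close> \<open>?M \<le> ereal c\<close> a by auto
  have "{0..<m} \<subseteq> T \<inter> U" using down M by auto
  then have "closure {0..<m} \<subseteq> T \<inter> U" using T U by (intro closure_minimal) auto
  then show "m \<in> T \<inter> U" using \<open>0 < m\<close> by auto
qed

text \<open>\<open>T\<close> and \<open>U\<close> are the parameter sets behind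
  \<open>alpha1\<close> and \<open>alpha2\<close>. Beyond \<open>a = 1\<close> the height
  \<open>h + a * (t - h)\<close> drops below \<open>t\<close>, whereas \<open>f\<close> is at least
  \<open>t\<close> on the part of the line in \<open>S\<close>; hence the step is at most 1.
  Interiority of \<open>(e, h)\<close> makes it positive.\<close>

lemma line_search:
  fixes f :: "'a::euclidean_space \<Rightarrow> ereal"
  assumes cl: "closed (epi f)" "closed S" and cv: "convex (epi f)" "convex S"
    and S: "e \<in> interior S" and epi: "(e, h) \<in> interior (epi f)"
    and lt: "t < h"
    and bd: "\<And>a. e + a *\<^sub>R (x - e) \<in> S \<Longrightarrow> ereal t \<le> f (e + a *\<^sub>R (x - e))"
  shows "f (fst (pi' f S e h x t)) \<le> ereal (snd (pi' f S e h x t))"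
    and "0 < alpha f S e h x t" and "alpha f S e h x t \<le> 1"
proof -
  define T where "T = {a. e + a *\<^sub>R (x - e) \<in> S}"
  define U where "U = {a. (e + a *\<^sub>R (x - e), h + a * (t - h)) \<in> epi f}"
  have alpha: "alpha f S e h x t = real_of_ereal (min (Sup (ereal ` T)) (Sup (ereal ` U)))"
    unfolding alpha_def alpha1_def alpha2_def T_def U_def mem_epi
    by (simp add: image_def Collect_disj_eq setcompr_eq_image)
  have "closed T" unfolding T_def
    by (rule closed_vimage[OF cl(2), unfolded vimage_def]) (intro continuous_intros)
  have "closed U" unfolding U_def
    by (rule closed_vimage[OF cl(1), unfolded vimage_def]) (intro continuous_intros)
  have "convex T" unfolding T_def convex_alt
  proof clarsimp
    fix a b u :: real
    assume *: "e + a *\<^sub>R (x - e) \<in> S" "e + b *\<^sub>R (x - e) \<in> S" "0 \<le> u" "u \<le> 1"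
    have "(1 - u) *\<^sub>R (e + a *\<^sub>R (x - e)) + u *\<^sub>R (e + b *\<^sub>R (x - e)) \<in> S"
      using * cv(2) by (intro convexD_alt)
    then show "e + ((1 - u) * a + u * b) *\<^sub>R (x - e) \<in> S" by (simp add: algebra_simps)
  qed
  have "convex U" unfolding U_def convex_alt
  proof clarsimp
    fix a b u :: real
    assume *: "(e + a *\<^sub>R (x - e), h + a * (t - h)) \<in> epi f"
      "(e + b *\<^sub>R (x - e), h + b * (t - h)) \<in> epi f" "0 \<le> u" "u \<le> 1"
    have "(1 - u) *\<^sub>R (e + a *\<^sub>R (x - e), h + a * (t - h))
        + u *\<^sub>R (e + b *\<^sub>R (x - e), h + b * (t - h)) \<in> epi f"
      using * cv(1) by (intro convexD_alt)
    then show "(e + ((1 - u) * a + u * b) *\<^sub>R (x - e), h + ((1 - u) * a + u * b) * (t - h)) \<in> epi f"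
      by (simp add: algebra_simps)
  qed
  have 0: "0 \<in> T" "0 \<in> U"
    using S epi interior_subset by (auto simp: T_def U_def)
  let ?V = "(\<lambda>a. e + a *\<^sub>R (x - e)) -` interior S \<inter>
    (\<lambda>a. (e + a *\<^sub>R (x - e), h + a * (t - h))) -` interior (epi f)"
  have "open ?V" by (intro open_Int open_vimage) (auto intro!: continuous_intros)
  moreover have "0 \<in> ?V" using S epi by simp
  ultimately obtain d where d: "d > 0" "cball 0 d \<subseteq> ?V" by (meson open_contains_cball)
  then have "d \<in> ?V" by (intro subsetD[OF d(2)]) simp
  then have dTU: "d \<in> T \<inter> U" using interior_subset[of S] interior_subset[of "epi f"] by (auto simp: T_def U_def)
  have le1: "a \<le> 1" if "a \<in> T \<inter> U" for a
  proof (rule ccontr)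
    assume "\<not> a \<le> 1"
    then have "a > 1" by simp
    have "ereal t \<le> f (e + a *\<^sub>R (x - e))" using that by (intro bd) (auto simp: T_def)
    also have "\<dots> \<le> ereal (h + a * (t - h))" using that by (auto simp: U_def mem_epi)
    finally have "(a - 1) * (h - t) \<le> 0" by (simp add: algebra_simps)
    then show False using \<open>a > 1\<close> lt by (simp add: mult_le_0_iff)
  qed
  note min_Sup_closed_convex[OF \<open>closed T\<close> \<open>convex T\<close> 0(1) \<open>closed U\<close> \<open>convex U\<close> 0(2) dTU d(1) le1,
      folded alpha]
  then show "f (fst (pi' f S e h x t)) \<le> ereal (snd (pi' f S e h x t))"
    and "0 < alpha f S e h x t" and "alpha f S e h x t \<le> 1"
    by (auto simp: pi'_def U_def mem_epi)
qed

section \<open>Attainment of the optimal value\<close>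

lemma opt_val_attained:
  fixes f :: "'a::euclidean_space \<Rightarrow> ereal" and A :: "'a \<Rightarrow> 'b::real_vector"
  assumes cl: "closed (epi f)" "closed S" and A: "linear A"
    and bdd: "bounded (init_level_set f A b S e)"
    and e: "e \<in> Feas A b S" and opt: "ereal s = opt_val f A b S"
  shows "\<exists>y \<in> init_level_set f A b S e. f y = ereal s"
proof (cases "f e = ereal s")
  case True
  then show ?thesis using e by (auto simp: init_level_set_def)
next
  case False
  have lower: "ereal s \<le> f y" if "y \<in> Feas A b S" for y
    using that unfolding opt opt_val_def by (rule INF_lower)
  then have lt: "ereal s < f e" using False e by (simp add: less_le)
  have ex: "\<exists>y\<in>init_level_set f A b S e. f y \<le> ereal (s + inverse (real (Suc n)))" for n
  proof -
    \<comment> \<open>Since \<open>f e\<close> is not optimal here, near-optimal points can also be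
      chosen below \<open>f e\<close>, which puts them into the bounded level set.\<close>
    have "opt_val f A b S < min (f e) (ereal (s + inverse (real (Suc n))))"
      using lt by (simp add: opt[symmetric])
    then obtain y where "y \<in> Feas A b S" "f y < min (f e) (ereal (s + inverse (real (Suc n))))"
      unfolding opt_val_def INF_less_iff by blast
    then show ?thesis by (auto simp: init_level_set_def intro!: bexI[of _ y])
  qed
  then obtain Y where Y: "\<And>n. Y n \<in> init_level_set f A b S e"
    "\<And>n. f (Y n) \<le> ereal (s + inverse (real (Suc n)))"
    by metis
  have "bounded (range Y)" using bdd by (rule bounded_subset) (auto simp: Y)
  then obtain y r where r: "strict_mono r" and lim: "(Y \<circ> r) \<longlonglongrightarrow> y"
    using bounded_imp_convergent_subsequence by blast
  have "(\<lambda>n. (Y (r n), s + inverse (real (Suc (r n))))) \<longlonglongrightarrow> (y, s + 0)"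
    using lim LIMSEQ_subseq_LIMSEQ[OF LIMSEQ_inverse_real_of_nat r]
    by (intro tendsto_Pair tendsto_add tendsto_const) (auto simp: o_def)
  then have "(y, s + 0) \<in> epi f"
    by (rule Lim_in_closed_set[OF cl(1), rotated 2]) (use Y(2) in \<open>auto simp: mem_epi\<close>)
  then have fy: "f y \<le> ereal s" by (simp add: mem_epi)
  \<comment> \<open>The range of \<open>A\<close> carries no topology, so \<open>A y = b\<close> is
    passed to the limit through the closed subspace of kernel vectors.\<close>
  have sub: "subspace {w. A w = 0}" using A by (rule linear_subspace_kernel)
  have AY: "A (Y n) = b" "Y n \<in> S" for n using Y(1)[of n] by (auto simp: init_level_set_def Feas_def)
  have "(\<lambda>n. Y (r n) - e) \<longlonglongrightarrow> y - e"
    using lim by (intro tendsto_diff tendsto_const) (simp add: o_def)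
  then have "y - e \<in> {w. A w = 0}"
    by (rule Lim_in_closed_set[OF closed_subspace[OF sub], rotated 2])
      (use e A in \<open>auto simp: AY linear_diff Feas_def\<close>)
  moreover have "y \<in> S"
    using lim by (rule Lim_in_closed_set[OF cl(2), rotated 2]) (auto simp: AY)
  ultimately have "y \<in> Feas A b S"
    using e A by (auto simp: Feas_def linear_diff)
  then show ?thesis using lower fy lt by (auto simp: init_level_set_def intro!: bexI[of _ y] antisym)
qed

section \<open>Orthogonal projection and the Polyak step\<close>

lemma ortho_proj_subspace:
  fixes V :: "'a::euclidean_space set"
  assumes "subspace V"
  shows "ortho_proj V g \<in> V" and "w \<in> V \<Longrightarrow> ortho_proj V g \<bullet> w = g \<bullet> w"
proof -
  have "\<exists>!p. p \<in> V \<and> (\<forall>w\<in>V. orthogonal (g - p) w)"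
  proof (rule ex_ex1I)
    obtain y u where yu: "y \<in> span V" "\<And>w. w \<in> span V \<Longrightarrow> orthogonal u w" "g = y + u"
      using orthogonal_subspace_decomp_exists by metis
    then show "\<exists>p. p \<in> V \<and> (\<forall>w\<in>V. orthogonal (g - p) w)"
      using assms by (intro exI[of _ y]) (auto simp: span_eq_iff[THEN iffD2])
  next
    fix p q
    assume p: "p \<in> V \<and> (\<forall>w\<in>V. orthogonal (g - p) w)" and q: "q \<in> V \<and> (\<forall>w\<in>V. orthogonal (g - q) w)"
    then have "p - q \<in> V" using assms by (simp add: subspace_diff)
    then have "(g - p) \<bullet> (p - q) = 0" "(g - q) \<bullet> (p - q) = 0"
      using p q by (auto simp: orthogonal_def)
    then have "(p - q) \<bullet> (p - q) = 0" by (simp add: inner_diff_left)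
    then show "p = q" by simp
  qed
  then have *: "ortho_proj V g \<in> V \<and> (\<forall>w\<in>V. orthogonal (g - ortho_proj V g) w)"
    unfolding ortho_proj_def by (rule theI')
  then show "ortho_proj V g \<in> V" by blast
  show "ortho_proj V g \<bullet> w = g \<bullet> w" if "w \<in> V"
    using * that by (simp add: orthogonal_def inner_diff_left)
qed

text \<open>Expanding the square, the step shortens the squared distance to \<open>y\<close> by at
  least \<open>c\<^sup>2 / (norm p)\<^sup>2\<close>, and \<open>norm p\<close> is at most
  \<open>1 / r\<close>. If \<open>p = 0\<close>, then \<open>c = 0\<close> is forced and the step is
  zero.\<close>

lemma polyak_step:
  fixes x p y :: "'a::real_inner"
  assumes c: "0 \<le> c" "c \<le> p \<bullet> (x - y)" and p: "norm p * r \<le> 1" and r: "0 < r"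
  shows "(norm (x - (c / (norm p)\<^sup>2) *\<^sub>R p - y))\<^sup>2 \<le> (norm (x - y))\<^sup>2 - (c * r)\<^sup>2"
proof (cases "p = 0")
  case True
  then show ?thesis using c by simp
next
  case False
  define n where "n = (norm p)\<^sup>2"
  have n: "n > 0" using False by (simp add: n_def)
  define w where "w = x - y"
  have "(norm (x - (c / n) *\<^sub>R p - y))\<^sup>2 = (norm (w - (c / n) *\<^sub>R p))\<^sup>2"
    by (simp add: w_def algebra_simps)
  also have "\<dots> = (norm w)\<^sup>2 - 2 * (c / n) * (p \<bullet> w) + (c / n)\<^sup>2 * n"
    unfolding n_def power2_norm_eq_inner
    by (simp add: inner_diff_left inner_diff_right inner_commute power2_eq_square)
  also have "\<dots> \<le> (norm w)\<^sup>2 - 2 * (c / n) * c + (c / n)\<^sup>2 * n"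
    using c n by (intro add_right_mono diff_left_mono mult_left_mono) (auto simp: w_def)
  also have "\<dots> = (norm w)\<^sup>2 - c\<^sup>2 / n"
    using n by (simp add: power2_eq_square field_simps)
  also have "\<dots> \<le> (norm w)\<^sup>2 - (c * r)\<^sup>2"
  proof -
    have "n * r\<^sup>2 \<le> 1"
      using power_mono[OF p, of 2] r by (simp add: n_def power_mult_distrib)
    then have "c\<^sup>2 * (n * r\<^sup>2) \<le> c\<^sup>2" by (simp add: mult_left_le)
    then have "(c * r)\<^sup>2 \<le> c\<^sup>2 / n" using n by (simp add: power_mult_distrib field_simps)
    then show ?thesis by simp
  qed
  finally show ?thesis by (simp add: n_def w_def)
qed

section \<open>The radius \<open>r_hat\<close> and the estimates it yields\<close>

lemma less_r_hat:
  assumes "\<rho> < r_hat f A b S e h" and "norm (y - e) \<le> \<rho>" and "A y = b"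
  shows "y \<in> S" and "f y \<le> ereal h"
proof -
  let ?X = "{r::real. \<forall>x. norm (x - e) \<le> r \<and> A x = b \<longrightarrow> x \<in> S \<and> f x \<le> ereal h}"
  \<comment> \<open>A negative radius is vacuously admissible, so the set is nonempty and every
    number below its supremum is exceeded by a member.\<close>
  have "\<not> norm (x - e) \<le> - 1" for x using norm_ge_zero[of "x - e"] by linarith
  then have "- 1 \<in> ?X" by auto
  then obtain r where "r \<in> ?X" "\<rho> < r"
    using assms(1) less_cSupE[of \<rho> ?X] unfolding r_hat_def by blast
  then show "y \<in> S" "f y \<le> ereal h" using assms by auto
qed

text \<open>A ball inside the interiors gives one positive radius, but comparing it with a real
  supremum also requires an upper bound for the radii. The kernel vector \<open>v\<close> supplies
  one, via a point \<open>w\<close> beyond the bounded level set.\<close>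

lemma r_hat_pos:
  fixes f :: "'a::euclidean_space \<Rightarrow> ereal" and A :: "'a \<Rightarrow> 'b::real_vector"
  assumes cv: "convex (epi f)" and A: "linear A" "A e = b" "A v = 0" "v \<noteq> 0"
    and S: "e \<in> interior S" and epi: "(e, h) \<in> interior (epi f)" and fe: "f e = ereal s" "s < h"
    and bdd: "bounded (init_level_set f A b S e)"
  shows "0 < r_hat f A b S e h"
proof -
  let ?X = "{r::real. \<forall>x. norm (x - e) \<le> r \<and> A x = b \<longrightarrow> x \<in> S \<and> f x \<le> ereal h}"
  let ?V = "interior S \<inter> (\<lambda>y. (y, h)) -` interior (epi f)"
  have "open ?V" by (intro open_Int open_vimage) (auto intro!: continuous_intros)
  moreover have "e \<in> ?V" using S epi by simp
  ultimately obtain d where d: "d > 0" "cball e d \<subseteq> ?V" by (meson open_contains_cball)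
  have "d \<in> ?X"
  proof (clarify, intro conjI)
    fix y assume "norm (y - e) \<le> d"
    then have "y \<in> ?V" using d(2) by (auto simp: dist_norm norm_minus_commute)
    then show "y \<in> S" "f y \<le> ereal h"
      using interior_subset[of S] interior_subset[of "epi f"] by (auto simp: mem_epi[symmetric])
  qed
  moreover have "bdd_above ?X"
  proof -
    obtain B where B: "\<And>y. y \<in> init_level_set f A b S e \<Longrightarrow> norm (y - e) \<le> B"
      using bdd unfolding bounded_any_center[of _ e] by (auto simp: dist_norm norm_minus_commute)
    define w where "w = e + ((\<bar>B\<bar> + 1) / norm v) *\<^sub>R v"
    have nw: "norm (w - e) = \<bar>B\<bar> + 1" using A by (simp add: w_def)
    have Aw: "A (e + a *\<^sub>R (w - e)) = b" for a
      using A by (simp add: w_def linear_add linear_scale)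
    have "w \<notin> init_level_set f A b S e" using B nw by fastforce
    \<comment> \<open>A radius above \<open>R\<close> would put \<open>w\<close> so close to \<open>e\<close>, relative to a point where \<open>f \<le> h\<close>, that
      convexity forces \<open>f w \<le> m\<close>.\<close>
    have "\<exists>m>s. \<not> f w \<le> ereal m \<or> w \<notin> S"
    proof -
      have "w \<notin> S \<or> ereal s < f w"
        using \<open>w \<notin> _\<close> Aw[of 1] fe by (auto simp: init_level_set_def Feas_def)
      then show ?thesis
      proof
        assume "ereal s < f w"
        then obtain c where c: "ereal s < c" "c < f w" using dense by blast
        then obtain m where "c = ereal m" by (cases c) auto
        then show ?thesis using c by (auto simp: not_le)
      qed (auto intro: gt_ex)
    qed
    then obtain m where m: "s < m" "\<not> f w \<le> ereal m \<or> w \<notin> S" by blast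
    \<comment> \<open>Between \<open>e\<close> and \<open>e + k *\<^sub>R (w - e)\<close>, the point
      \<open>w\<close> has weight \<open>1 / k\<close> and value at most
      \<open>s + (h - s) / k\<close>. This is at most \<open>m\<close> once \<open>k\<close> reaches
      \<open>(h - s) / (m - s)\<close>; the maximum with 1 keeps \<open>1 / k\<close> a convex
      weight.\<close>
    define R where "R = (\<bar>B\<bar> + 1) * max 1 ((h - s) / (m - s))"
    have "r \<le> R" if r: "r \<in> ?X" for r
    proof (rule ccontr)
      assume "\<not> r \<le> R"
      define k where "k = max 1 ((h - s) / (m - s))"
      have k: "k \<ge> 1" "h - s \<le> k * (m - s)" using m by (auto simp: k_def field_simps max_def)
      have "norm (k *\<^sub>R (w - e)) \<le> r"
        using \<open>\<not> r \<le> R\<close> nw k by (simp add: R_def k_def mult.commute)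
      then have "e + k *\<^sub>R (w - e) \<in> S" "f (e + k *\<^sub>R (w - e)) \<le> ereal h"
        using r Aw by auto
      have "w \<in> S"
      proof -
        have "norm (w - e) \<le> norm (k *\<^sub>R (w - e))" using k mult_right_mono[of 1 k "norm (w - e)"] by simp
        then show ?thesis using \<open>norm (k *\<^sub>R (w - e)) \<le> r\<close> r Aw[of 1] by auto
      qed
      have "(1 - 1 / k) *\<^sub>R (e, s) + (1 / k) *\<^sub>R (e + k *\<^sub>R (w - e), h) \<in> epi f"
        using cv k fe \<open>f (e + k *\<^sub>R (w - e)) \<le> ereal h\<close>
        by (intro convexD_alt) (auto simp: mem_epi)
      moreover have "(1 - 1 / k) *\<^sub>R (e, s) + (1 / k) *\<^sub>R (e + k *\<^sub>R (w - e), h) = (w, s + (h - s) / k)"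
        using k by (simp add: algebra_simps diff_divide_distrib)
      ultimately have "f w \<le> ereal (s + (h - s) / k)" by (simp add: mem_epi)
      also have "\<dots> \<le> ereal m" using k by (simp add: field_simps)
      finally show False using m \<open>w \<in> S\<close> by simp
    qed
    then show ?thesis by (auto intro!: bdd_aboveI[of _ R])
  qed
  ultimately show ?thesis unfolding r_hat_def using d(1) cSup_upper[of d ?X] by linarith
qed

lemma opt_gap_at_center:
  fixes f :: "'a::euclidean_space \<Rightarrow> ereal" and A :: "'a \<Rightarrow> 'b::real_vector"
  assumes cv: "convex (epi f)" and A: "linear A" "A e = b" "A y = b"
    and fe: "f e = ereal s" and fy: "f y = ereal t"
    and r: "0 < r" "r \<le> r_hat f A b S e h"
  shows "(s - t) * r \<le> norm (e - y) * (h - s)"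
proof (cases "e = y")
  case True
  then show ?thesis using fe fy by simp
next
  case False
  define d where "d = norm (e - y)"
  have d: "d > 0" using False by (simp add: d_def)
  \<comment> \<open>The supremum itself need not be an admissible radius, so the bound is shown for
    smaller radii and then passed to the limit.\<close>
  have *: "(s - t) * \<rho> \<le> d * (h - s)" if \<rho>: "0 < \<rho>" "\<rho> < r" for \<rho>
  proof -
    define w where "w = e + (\<rho> / d) *\<^sub>R (e - y)"
    have "norm (w - e) \<le> \<rho>" using d \<rho> by (simp add: w_def d_def)
    moreover have "A w = b" using A by (simp add: w_def linear_add linear_scale linear_diff)
    ultimately have "f w \<le> ereal h" using \<rho> r by (intro less_r_hat(2)[of \<rho> f A b S e h]) auto
    \<comment> \<open>The point \<open>e\<close> lies on the segment from \<open>w\<close> to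
      \<open>y\<close>, at distance \<open>\<rho>\<close> from \<open>w\<close> and \<open>d\<close>
      from \<open>y\<close>; this fixes the weights.\<close>
    then have "(1 - \<rho> / (d + \<rho>)) *\<^sub>R (w, h) + (\<rho> / (d + \<rho>)) *\<^sub>R (y, t) \<in> epi f"
      using cv d \<rho> fy by (intro convexD_alt) (auto simp: mem_epi divide_simps)
    moreover have "(1 - \<rho> / (d + \<rho>)) *\<^sub>R w + (\<rho> / (d + \<rho>)) *\<^sub>R y = e"
    proof -
      define a where "a = \<rho> / (d + \<rho>)"
      have a: "(1 - a) * (\<rho> / d) = a" using d \<rho> by (simp add: a_def field_simps)
      have "(1 - a) *\<^sub>R w + a *\<^sub>R y = (1 - a) *\<^sub>R e + ((1 - a) * (\<rho> / d)) *\<^sub>R (e - y) + a *\<^sub>R y"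
        by (simp add: w_def scaleR_add_right)
      also have "\<dots> = e" unfolding a by (simp add: algebra_simps)
      finally show ?thesis by (simp add: a_def)
    qed
    ultimately have "s \<le> (1 - \<rho> / (d + \<rho>)) * h + (\<rho> / (d + \<rho>)) * t"
      by (simp add: mem_epi fe)
    also have "\<dots> = (d * h + \<rho> * t) / (d + \<rho>)"
      using d \<rho> by (simp add: divide_simps)
    finally show ?thesis using d \<rho> by (simp add: field_simps)
  qed
  have "(s - t) * r \<le> d * (h - s)"
  proof (rule tendsto_upperbound)
    show "((\<lambda>\<rho>. (s - t) * \<rho>) \<longlongrightarrow> (s - t) * r) (at_left r)" by (intro tendsto_intros)
    show "eventually (\<lambda>\<rho>. (s - t) * \<rho> \<le> d * (h - s)) (at_left r)"
      using eventually_at_left[of 0 r] r * by auto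
  qed simp
  then show ?thesis by (simp add: d_def)
qed

lemma norm_proj_supports_le:
  fixes f :: "'a::euclidean_space \<Rightarrow> ereal" and A :: "'a \<Rightarrow> 'b::real_vector"
  assumes sup: "supports (epi f \<inter> S \<times> UNIV) (e, h) z g" and A: "linear A" "A e = b"
    and r: "0 < r" "r \<le> r_hat f A b S e h"
  shows "norm (ortho_proj {y. A y = 0} g) * r \<le> 1"
proof -
  define p where "p = ortho_proj {y. A y = 0} g"
  have sub: "subspace {y. A y = 0}" using A(1) by (rule linear_subspace_kernel)
  have Ap: "A p = 0" and gp: "g \<bullet> p = p \<bullet> p"
    using ortho_proj_subspace(1)[OF sub, of g] ortho_proj_subspace(2)[OF sub, of p g]
    by (auto simp: p_def)
  obtain d where d: "\<And>q. q \<in> epi f \<inter> S \<times> UNIV \<Longrightarrow> (g, d) \<bullet> (q - (e, h)) \<le> 1"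
    using sup unfolding supports_def by blast
  have *: "norm p * \<rho> \<le> 1" if \<rho>: "0 < \<rho>" "\<rho> < r" for \<rho>
  proof (cases "p = 0")
    case False
    define w where "w = e + (\<rho> / norm p) *\<^sub>R p"
    have "norm (w - e) \<le> \<rho>" using False \<rho> by (simp add: w_def)
    moreover have "A w = b" using A Ap by (simp add: w_def linear_add linear_scale)
    ultimately have "w \<in> S" "f w \<le> ereal h"
      using \<rho> r less_r_hat[of \<rho> f A b S e h w] by auto
    \<comment> \<open>At height \<open>h\<close> the last component of the difference vanishes, so
      the unknown \<open>d\<close> drops out.\<close>
    then have "(g, d) \<bullet> ((w, h) - (e, h)) \<le> 1" by (intro d) (auto simp: mem_epi)
    then have "\<rho> / norm p * (p \<bullet> p) \<le> 1" by (simp add: w_def gp)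
    also have "\<rho> / norm p * (p \<bullet> p) = norm p * \<rho>"
      using False by (simp add: dot_square_norm power2_eq_square)
    finally show ?thesis .
  qed simp
  have "norm p * r \<le> 1"
  proof (rule tendsto_upperbound)
    show "((\<lambda>\<rho>. norm p * \<rho>) \<longlongrightarrow> norm p * r) (at_left r)" by (intro tendsto_intros)
    show "eventually (\<lambda>\<rho>. norm p * \<rho> \<le> 1) (at_left r)"
      using eventually_at_left[of 0 r] r * by auto
  qed simp
  then show ?thesis by (simp add: p_def)
qed

section \<open>One step of Algorithm B, the iteration count and the final estimate\<close>

lemma algorithm_B_step:
  fixes f :: "'a::euclidean_space \<Rightarrow> ereal" and A :: "'a \<Rightarrow> 'b::real_vector"
  assumes S: "e \<in> interior S" and epi: "(e, h) \<in> interior (epi f)"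
    and A: "linear A" "A e = b" "A x = b" "A y = b"
    and y: "y \<in> S" "f y = ereal t"
    and a: "0 < a" "a \<le> 1" and z: "z = (e, h) + a *\<^sub>R ((x, t) - (e, h))"
    and g: "g \<in> G f S e h z" and p: "p = ortho_proj {y. A y = 0} g"
    and x': "x' = x + ((a - 1) / (a * (norm p)\<^sup>2)) *\<^sub>R p"
    and r: "0 < r" "r \<le> r_hat f A b S e h"
  shows "A x' = b" and "(norm (x' - y))\<^sup>2 \<le> (norm (x - y))\<^sup>2 - ((1 / a - 1) * r)\<^sup>2"
proof -
  have sup: "supports (epi f \<inter> S \<times> UNIV) (e, h) z g"
    using S epi g by (rule G_supports)
  have sub: "subspace {y. A y = 0}" using A(1) by (rule linear_subspace_kernel)
  have Ap: "A p = 0"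
    using ortho_proj_subspace(1)[OF sub, of g] by (simp add: p)
  then show "A x' = b" using A by (simp add: x' linear_add linear_scale)
  obtain d where d: "(g, d) \<bullet> (z - (e, h)) = 1" "(g, d) \<bullet> ((y, t) - (e, h)) \<le> 1"
    using sup y mem_epi[of y t f] unfolding supports_def by (metis IntI SigmaI UNIV_I order_refl)
  \<comment> \<open>The functional is \<open>1 / a\<close> at \<open>(x, t)\<close> and at most 1 at
    \<open>(y, t)\<close>, both relative to \<open>(e, h)\<close>. The heights agree, so subtraction
    cancels \<open>d\<close> and leaves the hypothesis of the Polyak step with
    \<open>c = 1 / a - 1\<close>.\<close>
  have "a * ((g, d) \<bullet> ((x, t) - (e, h))) = 1"
    using d(1) by (simp add: z algebra_simps)
  then have "(g, d) \<bullet> ((x, t) - (e, h)) = 1 / a" using a by (simp add: field_simps)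
  with d(2) have "1 / a - 1 \<le> g \<bullet> (x - y)"
    by (simp add: inner_prod_def inner_diff_right)
  also have "\<dots> = p \<bullet> (x - y)"
    unfolding p using A by (intro ortho_proj_subspace(2)[OF sub, symmetric]) (simp add: linear_diff)
  finally have le: "1 / a - 1 \<le> p \<bullet> (x - y)" .
  have "(a - 1) / (a * (norm p)\<^sup>2) = - ((1 / a - 1) / (norm p)\<^sup>2)"
    using a by (simp add: divide_simps)
  then have "x' = x - ((1 / a - 1) / (norm p)\<^sup>2) *\<^sub>R p" by (simp add: x')
  then show "(norm (x' - y))\<^sup>2 \<le> (norm (x - y))\<^sup>2 - ((1 / a - 1) * r)\<^sup>2"
    using polyak_step[OF _ le norm_proj_supports_le[OF sup A(1,2) r, folded p] r(1)] a by simp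
qed

text \<open>The logarithms add up to \<open>log 2 (w * q)\<close>, which is positive, and four times
  the quadratic term already exceeds \<open>w\<^sup>2\<close>.\<close>

lemma iteration_bound_ge:
  fixes q w :: real
  assumes "0 < q" "0 < w" "1 < w * q"
  shows "(q * w)\<^sup>2 \<le> 4 * q\<^sup>2 * (4 / 3 * w\<^sup>2 + 4 * w + log 2 w + log 2 q + 1)"
proof -
  have "log 2 w + log 2 q = log 2 (w * q)" using assms by (simp add: log_mult)
  also have "\<dots> > 0" using assms by simp
  finally have "w\<^sup>2 \<le> 4 * (4 / 3 * w\<^sup>2 + 4 * w + log 2 w + log 2 q + 1)"
    using assms(2) zero_le_power2[of w] by argo
  then have "q\<^sup>2 * w\<^sup>2 \<le> q\<^sup>2 * (4 * (4 / 3 * w\<^sup>2 + 4 * w + log 2 w + log 2 q + 1))"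
    by (intro mult_left_mono) auto
  then show ?thesis by (simp add: power_mult_distrib algebra_simps)
qed

theorem theorem1p2:
  fixes f :: "'a::euclidean_space \<Rightarrow> ereal"
    and S :: "'a set"
    and A :: "'a \<Rightarrow> 'b::real_vector"
    and b :: 'b
    and e :: 'a
    and fstar fhat D r eps :: real
    and x :: "nat \<Rightarrow> 'a"
    and z :: "nat \<Rightarrow> 'a \<times> real"
    and al :: "nat \<Rightarrow> real"
    and l :: nat
  assumes "\<And>y. f y \<noteq> -\<infinity>" and "lsc f" and "ereal_convex f"
    and "closed S" and "convex S" and "interior S \<noteq> {}"
    and "linear A" and "b \<in> range A"
    and "e \<in> interior (S \<inter> edom f)" and "A e = b"
    and "bounded (init_level_set f A b S e)"
    and "D = diameter (init_level_set f A b S e)"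
    and "ereal fstar = opt_val f A b S"
    and "ereal fhat > f e"
    and "r = r_hat f A b S e fhat"
    and "algorithm_B f S A fstar e fhat x z al"
    and "0 < eps" and "eps < 1"
    and "real l \<ge> 4 * (D / r)\<^sup>2 *
           (4 / 3 * ((1 - eps) / eps)\<^sup>2 + 4 * ((1 - eps) / eps)
            + log 2 ((1 - eps) / eps) + log 2 (D / r) + 1)"
  shows "(MIN k\<in>{..l}. (f (fst (z k)) - ereal fstar) / ereal (fhat - fstar)) \<le> ereal eps"
proof -
  note ninf = assms(1) and A = assms(7) and Ae = assms(10) and bdd = assms(11)
    and eps = assms(17,18)
  define w where "w = (1 - eps) / eps"
  have w: "w > 0" using eps by (simp add: w_def)
  have eS: "e \<in> interior S" and edom: "e \<in> interior (edom f)"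
    using assms(9) by (auto simp: interior_Int)
  have cv: "convex (epi f)" using assms(3) by (rule convex_epi)
  have cl: "closed (epi f)" using assms(2) by (rule closed_epi)
  have epi: "(e, fhat) \<in> interior (epi f)"
    using ninf assms(3) edom assms(14) by (rule interior_epi)
  have eF: "e \<in> Feas A b S" using eS Ae interior_subset by (auto simp: Feas_def)
  obtain s where s: "f e = ereal s"
    using assms(14) ninf[of e] by (cases "f e") auto
  have sh: "s < fhat" using assms(14) s by simp
  have lower: "ereal fstar \<le> f y" if "y \<in> Feas A b S" for y
    using that unfolding assms(13) opt_val_def by (rule INF_lower)
  have fs: "fstar \<le> s" using lower[OF eF] s by simp
  obtain y where y: "y \<in> init_level_set f A b S e" "f y = ereal fstar"
    using opt_val_attained[OF cl assms(4) A bdd eF assms(13)] by blast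
  have yS: "y \<in> S" "A y = b" using y by (auto simp: init_level_set_def Feas_def)
  have eL: "e \<in> init_level_set f A b S e" using eF by (simp add: init_level_set_def)
  have D: "norm (e - y) \<le> D"
    using diameter_bounded_bound[OF bdd eL y(1)] assms(12) by (simp add: dist_norm)
  have alg: "x 0 = e" "z 0 = (e, s)" "al 0 = alpha f S e fhat (x 0) fstar"
    and step: "\<And>k. \<exists>g \<in> G f S e fhat (z k). x (Suc k) = x k + ((al k - 1) /
        (al k * (norm (ortho_proj {y. A y = 0} g))\<^sup>2)) *\<^sub>R ortho_proj {y. A y = 0} g"
    and zS: "\<And>k. z (Suc k) = pi' f S e fhat (x (Suc k)) fstar"
    and alS: "\<And>k. al (Suc k) = alpha f S e fhat (x (Suc k)) fstar"
    using assms(16) s unfolding algorithm_B_def Let_def by auto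
  have al: "al k = alpha f S e fhat (x k) fstar" for k
    using alg alS by (cases k) auto

  \<comment> \<open>One index with a real upper bound \<open>m\<close> on \<open>f\<close>
    suffices.\<close>
  have reduce: ?thesis if "k \<le> l" "f (fst (z k)) \<le> ereal m" "m - fstar \<le> eps * (fhat - fstar)" for k m
  proof -
    have "f (fst (z k)) - ereal fstar \<le> ereal (m - fstar)"
      using ereal_minus_mono[OF that(2), of "ereal fstar" "ereal fstar"] by simp
    then have "(f (fst (z k)) - ereal fstar) / ereal (fhat - fstar)
        \<le> ereal (m - fstar) / ereal (fhat - fstar)"
      using sh fs by (intro ereal_divide_right_mono) auto
    also have "\<dots> \<le> ereal eps" using that(3) sh fs by (simp add: field_simps)
    finally have "(f (fst (z k)) - ereal fstar) / ereal (fhat - fstar) \<le> ereal eps" .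
    moreover have "(MIN k\<in>{..l}. (f (fst (z k)) - ereal fstar) / ereal (fhat - fstar))
        \<le> (f (fst (z k)) - ereal fstar) / ereal (fhat - fstar)"
      using that(1) by (intro Min_le) auto
    ultimately show ?thesis by (rule order_trans[rotated])
  qed

  show ?thesis
  \<comment> \<open>If \<open>D = 0\<close>, then \<open>e = y\<close> is optimal. This case is
    separate because the kernel of \<open>A\<close> may be trivial, and \<open>r\<close> then
    carries no information.\<close>
  proof (cases "D = 0")
    case True
    then have "s = fstar" using D y s by simp
    then show ?thesis using eps alg s sh fs by (intro reduce[of 0 s]) auto
  next
    case False
    \<comment> \<open>A second point of the level set differs from \<open>e\<close> by the nonzero
      kernel vector that \<open>r_hat_pos\<close> asks for.\<close>
    have "\<not> init_level_set f A b S e \<subseteq> {e}"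
    proof
      assume "init_level_set f A b S e \<subseteq> {e}"
      then have "init_level_set f A b S e = {e}" using eL by blast
      then show False using False assms(12) by simp
    qed
    then obtain v where "v \<noteq> e" "A v = b" by (auto simp: init_level_set_def Feas_def)
    then have rh: "0 < r_hat f A b S e fhat"
      using cv A Ae eS epi s sh bdd
      by (intro r_hat_pos[of f A e b "v - e" S fhat s]) (auto simp: linear_diff)
    then have r: "0 < r" "r \<le> r_hat f A b S e fhat" using assms(15) by auto
    have Dpos: "D > 0" using False D norm_ge_zero[of "e - y"] by linarith
    show ?thesis
    proof (cases "w * (D / r) \<le> 1")
      case True
      have "(s - fstar) * r \<le> D * (fhat - s)"
        using opt_gap_at_center[OF cv A Ae yS(2) s y(2) r] D sh
          mult_right_mono[OF D, of "fhat - s"] by linarith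
      then have "w * ((s - fstar) * r) \<le> (w * D) * (fhat - s)"
        using w mult_left_mono[of "(s - fstar) * r" "D * (fhat - s)" w] by (simp add: mult.assoc)
      also have "\<dots> \<le> r * (fhat - s)"
        using True r sh by (intro mult_right_mono) (auto simp: field_simps)
      finally have "w * (s - fstar) \<le> fhat - s" using r by simp
      then have "s - fstar \<le> eps * (fhat - fstar)"
        using eps by (simp add: w_def field_simps)
      then show ?thesis using alg s by (intro reduce[of 0 s]) auto
    next
      case False
      have ls: "0 < al k" "al k \<le> 1"
        "f (fst (pi' f S e fhat (x k) fstar)) \<le> ereal (snd (pi' f S e fhat (x k) fstar))"
        if "A (x k) = b" for k
      proof -
        have bd: "ereal fstar \<le> f (e + a *\<^sub>R (x k - e))" if "e + a *\<^sub>R (x k - e) \<in> S" for a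
          using that \<open>A (x k) = b\<close> A Ae
          by (intro lower) (auto simp: Feas_def linear_add linear_scale linear_diff)
        have "fstar < fhat" using fs sh by simp
        note line_search[where x = "x k", OF cl assms(4) cv assms(5) eS epi this bd]
        then show "0 < al k" "al k \<le> 1"
          "f (fst (pi' f S e fhat (x k) fstar)) \<le> ereal (snd (pi' f S e fhat (x k) fstar))"
          by (auto simp: al)
      qed
      \<comment> \<open>The initial pair \<open>(e, f e)\<close> also has the form \<open>pi'\<close>: the ray from \<open>(e, fhat)\<close> is vertical.\<close>
      have z: "z k = (e, fhat) + al k *\<^sub>R ((x k, fstar) - (e, fhat))" for k
      proof (cases k)
        case 0
        \<comment> \<open>For \<open>x = e\<close> the point does not move with the parameter, so
          only \<open>alpha2\<close> limits the step.\<close>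
        have "alpha1 S e e = \<infinity>"
          unfolding alpha1_def using eF by (intro ereal_top Sup_upper) (auto simp: Feas_def)
        moreover have "alpha2 f e fhat e fstar = ereal ((fhat - s) / (fhat - fstar))"
        proof -
          have "{ereal a | a. f (e + a *\<^sub>R (e - e)) \<le> ereal (fhat + a * (fstar - fhat))}
              = ereal ` {..(fhat - s) / (fhat - fstar)}"
            using fs sh by (auto simp: s field_simps)
          then show ?thesis
            unfolding alpha2_def by (intro Sup_eqI) auto
        qed
        ultimately have "al 0 = (fhat - s) / (fhat - fstar)"
          by (simp add: alg alpha_def)
        then have "fhat + al 0 * (fstar - fhat) = s" using fs sh by (simp add: field_simps)
        then show ?thesis using alg 0 by simp
      next
        case (Suc j)
        then show ?thesis by (simp add: zS alS pi'_def)
      qed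
      \<comment> \<open>This is the summed Polyak inequality, starting from
        \<open>norm (e - y) \<le> D\<close>. Feasibility for \<open>A\<close> is carried along since
        \<open>ls\<close> depends on it.\<close>
      have main: "A (x k) = b \<and>
          (norm (x k - y))\<^sup>2 + (\<Sum>i<k. ((1 / al i - 1) * r)\<^sup>2) \<le> D\<^sup>2" for k
      proof (induction k)
        case 0
        then show ?case using alg Ae D by (simp add: power_mono)
      next
        case (Suc k)
        obtain g where g: "g \<in> G f S e fhat (z k)" "x (Suc k) = x k + ((al k - 1) /
            (al k * (norm (ortho_proj {y. A y = 0} g))\<^sup>2)) *\<^sub>R ortho_proj {y. A y = 0} g"
          using step by blast
        show ?case
          using algorithm_B_step[OF eS epi A Ae _ yS(2,1) y(2) ls(1,2) z g(1) refl g(2) r] Suc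
          by auto
      qed
      have "\<exists>k\<le>l. 1 - al k \<le> eps"
      proof (rule ccontr)
        assume "\<not> ?thesis"
        then have "al k < 1 - eps" if "k \<le> l" for k using that by auto
        then have gt: "1 / w \<le> 1 / al k - 1" if "k \<le> l" for k
          using that ls[of k] main[of k] eps by (fastforce simp: w_def field_simps)
        \<comment> \<open>If all iterates up to \<open>l\<close> fail, the sum has
          \<open>Suc l\<close> large terms, so \<open>Suc l\<close> is at most
          \<open>(D / r * w)\<^sup>2\<close>, hence at most \<open>l\<close>. The extra term for
          index 0 is what gives the contradiction.\<close>
        have "real (Suc l) * ((1 / w) * r)\<^sup>2 = (\<Sum>i<Suc l. ((1 / w) * r)\<^sup>2)" by simp
        also have "\<dots> \<le> (\<Sum>i<Suc l. ((1 / al i - 1) * r)\<^sup>2)"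
          using gt w r by (intro sum_mono power_mono mult_right_mono) auto
        also have "\<dots> \<le> D\<^sup>2" using main[of "Suc l"] zero_le_power2[of "norm (x (Suc l) - y)"] by linarith
        finally have "real (Suc l) \<le> (D / r * w)\<^sup>2"
          using w r by (simp add: power_mult_distrib power_divide field_simps)
        also have "\<dots> \<le> real l"
          using iteration_bound_ge[of "D / r" w] False Dpos r w assms(19)
          by (simp add: w_def)
        finally show False by simp
      qed
      then obtain k where k: "k \<le> l" "1 - al k \<le> eps" by blast
      \<comment> \<open>The height of \<open>z k\<close> has relative error exactly
        \<open>1 - al k\<close>.\<close>
      have "f (fst (z k)) \<le> ereal (fhat + al k * (fstar - fhat))"
        using ls(3)[of k] main[of k] z[of k] al[of k] by (simp add: pi'_def)
      moreover have "fhat + al k * (fstar - fhat) - fstar \<le> eps * (fhat - fstar)"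
        using mult_right_mono[OF k(2), of "fhat - fstar"] fs sh by (simp add: algebra_simps)
      ultimately show ?thesis using k(1) by (intro reduce)
    qed
  qed
qed

end
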